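(* Let $\theta\in(0,1)$, $\ell\in\mathbb{N}$, $\mu,\Delta\in\mathbb{R}^\ell$ with $\Delta\ne0$. Let $(e_j)_{j\ge1}$ be a zero mean sequence of $\mathbb{R}^\ell$-valued random vectors and $(a_n)_n$ a non-decreasing sequence with limit $+\infty$ such that $a_n^{-1}\sum_{j=1}^ne_j\to0$ a.s. and $a_n=o(n)$. For $n\in\mathbb{N}$ put $v^*=\lfloor n\theta\rfloor$ and let the series $Y_j=f(Z_{k,j})$, $1\le j\le n$, satisfy $$Y_j=\begin{cases}e_j+\mu,&j\le v^*,\\ e_j+\mu-\Delta,&j>v^*.\end{cases}$$ Let $S_v=\frac1{\sqrt n}\big(\sum_{j=1}^vY_j-\frac vn\sum_{j=1}^nY_j\big)$, $1\le v\le n$, let $(\widetilde\Sigma_n)_n$ be a sequence of (random) positive definite $\ell\times\ell$ matrices, and let $$\widehat\theta_n=\frac1n\operatorname*{arg\,max}_{1\le v\le n}S_v^T\widetilde\Sigma_nS_v .$$ Suppose there is a measurable set $\Omega_0$ with probability $1$ such that $$\sup_{n\in\mathbb{N}}\frac{\|\widetilde\Sigma_n(\omega)\|}{\Delta^T\widetilde\Sigma_n(\omega)\Delta}<\infty\quad\text{for all }\omega\in\Omega_0 .$$ Then $\widehat\theta_n-\theta=O_{a.s.}(n^{-1}a_n)$.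
   Context: $Z_{k,j}\in\mathbb{R}^{2N_k}$ is the feature vector listing the (birth, death) pairs of the $k$-dimensional persistence diagram of the $j$-th observed random point cloud, $N_k=\binom{r}{k+1}$ with $r$ the number of points in each cloud, and $f:\mathbb{R}^{2N_k}\to\mathbb{R}^\ell$ is Lipschitz-continuous. The arg max denotes any maximizer. $U_n=O_{a.s.}(c_n)$ means that, almost surely, $\sup_n|U_n|/c_n<\infty$ (eventually). $\|\cdot\|$ on matrices is any fixed matrix norm. *)

theory Defs
  imports "HOL-Probability.Probability" "HOL-Library.Function_Algebras" "HOL-Library.Landau_Symbols"
begin

section \<open>Persistence diagrams of finite point clouds\<close>

text \<open>A cloud of r points is indexed by {..<r}, and a simplex is a nonempty set of indices.
  A filtration assigns to every simplex the scale at which it enters. It is kept arbitrary up to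
  monotonicity along faces; the Vietoris--Rips and Cech filtrations are the usual instances.\<close>

definition is_filtration :: "nat \<Rightarrow> (nat set \<Rightarrow> real) \<Rightarrow> bool" where
  "is_filtration r \<phi> \<longleftrightarrow>
     (\<forall>\<sigma> \<tau>. \<sigma> \<noteq> {} \<and> \<sigma> \<subseteq> \<tau> \<and> \<tau> \<subseteq> {..<r} \<longrightarrow> \<phi> \<sigma> \<le> \<phi> \<tau>)"

definition full_complex :: "nat \<Rightarrow> nat set set" where
  "full_complex r = {\<sigma>. \<sigma> \<noteq> {} \<and> \<sigma> \<subseteq> {..<r}}"

definition complex_le :: "nat \<Rightarrow> (nat set \<Rightarrow> real) \<Rightarrow> real \<Rightarrow> nat set set" where
  "complex_le r \<phi> t = {\<sigma> \<in> full_complex r. \<phi> \<sigma> \<le> t}"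

definition complex_less :: "nat \<Rightarrow> (nat set \<Rightarrow> real) \<Rightarrow> real \<Rightarrow> nat set set" where
  "complex_less r \<phi> t = {\<sigma> \<in> full_complex r. \<phi> \<sigma> < t}"

definition scale_chain :: "'k::field \<Rightarrow> (nat set \<Rightarrow> 'k) \<Rightarrow> nat set \<Rightarrow> 'k" where
  "scale_chain a c = (\<lambda>\<sigma>. a * c \<sigma>)"

global_interpretation chain_space: vector_space "scale_chain :: 'k::field \<Rightarrow> _"
  by unfold_locales (auto simp: scale_chain_def fun_eq_iff algebra_simps)

definition chains :: "nat set set \<Rightarrow> nat \<Rightarrow> (nat set \<Rightarrow> 'k::field) set" where
  "chains K k = {c. \<forall>\<sigma>. c \<sigma> \<noteq> 0 \<longrightarrow> \<sigma> \<in> K \<and> card \<sigma> = Suc k}"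

text \<open>Simplices are oriented by the order of their vertices: the face of insert v \<tau> opposite
  to v carries the sign given by the position of v. Vertices have zero boundary (unreduced
  homology).\<close>

definition boundary :: "nat \<Rightarrow> (nat set \<Rightarrow> 'k::field) \<Rightarrow> nat set \<Rightarrow> 'k" where
  "boundary r c = (\<lambda>\<tau>. if \<tau> = {} then 0
     else \<Sum>v\<in>{..<r} - \<tau>. (-1) ^ card {u \<in> \<tau>. u < v} * c (insert v \<tau>))"

definition cycles :: "nat \<Rightarrow> nat set set \<Rightarrow> nat \<Rightarrow> (nat set \<Rightarrow> 'k::field) set" where
  "cycles r K k = {c \<in> chains K k. boundary r c = (\<lambda>_. 0)}"

definition boundaries :: "nat \<Rightarrow> nat set set \<Rightarrow> nat \<Rightarrow> (nat set \<Rightarrow> 'k::field) set" where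
  "boundaries r L k = boundary r ` chains L (Suc k)"

text \<open>For K contained in L: the rank of the map on k-th homology with coefficients in 'k that is
  induced by the inclusion, i.e. dim of Z(K) / (Z(K) \<inter> B(L)).\<close>

definition persistent_betti ::
    "'k::field itself \<Rightarrow> nat \<Rightarrow> nat \<Rightarrow> nat set set \<Rightarrow> nat set set \<Rightarrow> int" where
  "persistent_betti _ r k K L =
     int (chain_space.dim (cycles r K k :: (nat set \<Rightarrow> 'k) set))
   - int (chain_space.dim (cycles r K k \<inter> boundaries r L k :: (nat set \<Rightarrow> 'k) set))"

text \<open>Multiplicity of the point (b, d), b < d, in the k-dimensional persistence diagram, by
  inclusion-exclusion. As the filtration takes finitely many values on simplices, the complexes at
  b - \<epsilon> and d - \<epsilon> for small \<epsilon> > 0 are the strict sublevel complexes. The death \<infinity> belongs to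
  classes that survive in the full complex.\<close>

definition pd_multiplicity ::
    "'k::field itself \<Rightarrow> nat \<Rightarrow> (nat set \<Rightarrow> real) \<Rightarrow> nat \<Rightarrow> real \<Rightarrow> ereal \<Rightarrow> int" where
  "pd_multiplicity F r \<phi> k b d =
     (let \<beta> = persistent_betti F r k; Kb = complex_le r \<phi> b; Kb' = complex_less r \<phi> b in
      if d = \<infinity> then \<beta> Kb (full_complex r) - \<beta> Kb' (full_complex r)
      else let Kd = complex_le r \<phi> (real_of_ereal d); Kd' = complex_less r \<phi> (real_of_ereal d) in
           (\<beta> Kb Kd' - \<beta> Kb' Kd') - (\<beta> Kb Kd - \<beta> Kb' Kd))"

text \<open>The vector z lists the pairs (z $ (i, 1), z $ (i, 2)) of births and deaths. Off the diagonal
  these are the points of the diagram with multiplicity, in any order; unused entries are padded by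
  points on the diagonal. A class that never dies has no real death coordinate, so for it the
  second entry is an unrestricted placeholder.\<close>

definition is_feature_vector ::
    "'k::field itself \<Rightarrow> nat \<Rightarrow> (nat set \<Rightarrow> real) \<Rightarrow> nat \<Rightarrow> real^('N::finite \<times> 2) \<Rightarrow> bool" where
  "is_feature_vector F r \<phi> k z \<longleftrightarrow>
     (\<exists>d :: 'N \<Rightarrow> ereal.
        (\<forall>i. ereal (z $ (i, 1)) \<le> d i) \<and>
        (\<forall>i. d i \<noteq> \<infinity> \<longrightarrow> d i = ereal (z $ (i, 2))) \<and>
        (\<forall>b t. ereal b < t \<longrightarrow>
           int (card {i. z $ (i, 1) = b \<and> d i = t}) = pd_multiplicity F r \<phi> k b t))"

section \<open>Change point estimation\<close>

definition positive_definite :: "real^'n^'n \<Rightarrow> bool" where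
  "positive_definite A \<longleftrightarrow> transpose A = A \<and> (\<forall>x. x \<noteq> 0 \<longrightarrow> x \<bullet> (A *v x) > 0)"

definition is_matrix_norm :: "(real^'n^'m \<Rightarrow> real) \<Rightarrow> bool" where
  "is_matrix_norm N \<longleftrightarrow>
     (\<forall>A. 0 \<le> N A) \<and> (\<forall>A. N A = 0 \<longleftrightarrow> A = 0) \<and>
     (\<forall>c A. N (c *\<^sub>R A) = \<bar>c\<bar> * N A) \<and> (\<forall>A B. N (A + B) \<le> N A + N B)"

definition cusum :: "nat \<Rightarrow> (nat \<Rightarrow> 'a::real_vector) \<Rightarrow> nat \<Rightarrow> 'a" where
  "cusum n Y v = (1 / sqrt (real n)) *\<^sub>R ((\<Sum>j=1..v. Y j) - (real v / real n) *\<^sub>R (\<Sum>j=1..n. Y j))"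

definition as_bigo :: "'a measure \<Rightarrow> (nat \<Rightarrow> 'a \<Rightarrow> real) \<Rightarrow> (nat \<Rightarrow> real) \<Rightarrow> bool" where
  "as_bigo M U c \<longleftrightarrow> (AE \<omega> in M. (\<lambda>n. U n \<omega>) \<in> O(c))"

end

theory Submission
  imports Defs
begin

text \<open>Up to the factor $\sqrt n$, $S_v$ is $h(v)\Delta$ plus a centred partial sum of the noise, where
  the tent function $h(v) = \min(v, v^*) - v v^*/n$ peaks at $v^*$ with slopes bounded away from $0$.
  Monotonicity of $(a_n)$ makes the noise $O(a_n)$ uniformly in $v$, and the boundedness
  assumption transfers this to the norm $x \mapsto (x^T \widetilde\Sigma_n x)^{1/2}$ relative to the
  length of $\Delta$. The triangle inequality in that norm turns maximality of $v$ into
  $h(v^*) - h(v) = O(a_n)$, hence $|v - v^*| = O(a_n)$.\<close>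

section \<open>The norm attached to a positive definite matrix\<close>

text \<open>The objective maximised by the estimator is the square of this function at
  \<open>cusum\<close>; the square root makes the triangle inequality available.\<close>

definition pd_norm :: "real^'n^'n \<Rightarrow> real^'n \<Rightarrow> real" where
  "pd_norm A x = sqrt (x \<bullet> (A *v x))"

lemma positive_definite_nonneg: "positive_definite A \<Longrightarrow> 0 \<le> x \<bullet> (A *v x)"
  by (cases "x = 0") (auto simp: positive_definite_def less_imp_le)

lemma pd_norm_nonneg: "positive_definite A \<Longrightarrow> 0 \<le> pd_norm A x"
  by (simp add: pd_norm_def positive_definite_nonneg)

lemma pd_norm_pos: "positive_definite A \<Longrightarrow> x \<noteq> 0 \<Longrightarrow> 0 < pd_norm A x"
  by (simp add: pd_norm_def positive_definite_def)

lemma pd_norm_power2: "positive_definite A \<Longrightarrow> (pd_norm A x)\<^sup>2 = x \<bullet> (A *v x)"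
  by (simp add: pd_norm_def positive_definite_nonneg)

lemma pd_norm_scaleR: "pd_norm A (c *\<^sub>R x) = \<bar>c\<bar> * pd_norm A x"
  by (simp add: pd_norm_def matrix_vector_mult_scaleR real_sqrt_mult flip: mult.assoc)

lemma positive_definite_commute:
  assumes "positive_definite A"
  shows "y \<bullet> (A *v x) = x \<bullet> (A *v y)"
proof -
  have "y \<bullet> (A *v x) = (transpose A *v y) \<bullet> x"
    by (simp add: dot_lmul_matrix)
  also have "transpose A = A"
    using assms by (simp add: positive_definite_def)
  finally show ?thesis
    by (simp add: inner_commute)
qed

lemma positive_definite_Cauchy_Schwarz:
  assumes A: "positive_definite A"
  shows "x \<bullet> (A *v y) \<le> pd_norm A x * pd_norm A y"
proof (cases "y = 0")
  case False
  define q where "q x = x \<bullet> (A *v x)" for x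
  define b where "b = x \<bullet> (A *v y)"
  have qy: "0 < q y"
    using A False by (simp add: positive_definite_def q_def)
  \<comment> \<open>\<open>(b / q y) *\<^sub>R y\<close> is the projection of \<open>x\<close> onto
    \<open>y\<close> in the inner product given by \<open>A\<close>; this coefficient minimises
    \<open>q (x - t *\<^sub>R y)\<close> over \<open>t\<close>.\<close>
  have "0 \<le> q (x - (b / q y) *\<^sub>R y)"
    unfolding q_def by (rule positive_definite_nonneg[OF A])
  also have "\<dots> = q x - 2 * (b / q y) * b + (b / q y)\<^sup>2 * q y"
    by (simp add: q_def b_def matrix_vector_mult_diff_distrib matrix_vector_mult_scaleR
        inner_diff_left inner_diff_right positive_definite_commute[OF A, of y x]
        power2_eq_square algebra_simps)
  also have "\<dots> = q x - b\<^sup>2 / q y"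
    using qy by (simp add: power2_eq_square field_simps)
  finally have "b\<^sup>2 \<le> q x * q y"
    using qy by (simp add: field_simps)
  then have "b\<^sup>2 \<le> (pd_norm A x * pd_norm A y)\<^sup>2"
    by (simp add: power_mult_distrib pd_norm_power2[OF A] q_def)
  then show ?thesis
    unfolding b_def by (rule power2_le_imp_le) (simp add: pd_norm_nonneg[OF A])
qed (simp add: pd_norm_def)

lemma pd_norm_triangle:
  assumes A: "positive_definite A"
  shows "pd_norm A (x + y) \<le> pd_norm A x + pd_norm A y"
proof (rule power2_le_imp_le)
  have "(pd_norm A (x + y))\<^sup>2 = x \<bullet> (A *v x) + 2 * (x \<bullet> (A *v y)) + y \<bullet> (A *v y)"
    by (simp add: pd_norm_power2[OF A] matrix_vector_right_distrib inner_add_left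
        inner_add_right positive_definite_commute[OF A, of y x])
  also have "\<dots> \<le> (pd_norm A x + pd_norm A y)\<^sup>2"
    using positive_definite_Cauchy_Schwarz[OF A, of x y]
    by (simp add: power2_sum pd_norm_power2[OF A])
  finally show "(pd_norm A (x + y))\<^sup>2 \<le> (pd_norm A x + pd_norm A y)\<^sup>2" .
qed (simp add: pd_norm_nonneg[OF A])

section \<open>Comparison with norms of the matrix\<close>

text \<open>The library norm on matrices is the Frobenius norm, the Euclidean norm of the vector of
  row norms, so Cauchy-Schwarz applies row by row.\<close>

lemma norm_matrix_vector_mult_le:
  fixes A :: "real^'n^'m"
  shows "norm (A *v x) \<le> norm A * norm x"
proof -
  have "norm (A *v x) \<le> L2_set (\<lambda>i. norm (A $ i) * norm x) UNIV"
    unfolding norm_vec_def[of "A *v x"]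
    by (intro L2_set_mono)
       (simp_all add: matrix_vector_mul_component Cauchy_Schwarz_ineq2)
  also have "\<dots> = norm A * norm x"
    by (simp add: norm_vec_def[of A] L2_set_left_distrib)
  finally show ?thesis .
qed

text \<open>Together with a bound for \<open>norm A\<close> by a multiple of the quadratic form at
  \<Delta>, this yields the assumption on \<open>K\<close> in
  \<open>change_point_distance\<close>.\<close>

lemma pd_norm_le:
  assumes "positive_definite A"
  shows "pd_norm A x \<le> sqrt (norm A) * norm x"
proof -
  have "x \<bullet> (A *v x) \<le> norm x * norm (A *v x)"
    by (rule norm_cauchy_schwarz)
  also have "\<dots> \<le> norm x * (norm A * norm x)"
    by (intro mult_left_mono norm_matrix_vector_mult_le) simp
  finally have "x \<bullet> (A *v x) \<le> norm A * (norm x)\<^sup>2"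
    by (simp add: power2_eq_square algebra_simps)
  then show ?thesis
    unfolding pd_norm_def by (metis norm_ge_zero real_sqrt_le_mono real_sqrt_mult real_sqrt_unique)
qed

text \<open>A norm on a finite-dimensional space is convex, hence continuous, so it attains a
  positive minimum on the compact Frobenius unit sphere; homogeneity extends the bound to all
  matrices. This turns a bound stated in an arbitrary matrix norm into one for
  \<open>norm\<close>.\<close>

lemma matrix_norm_dominates:
  fixes N :: "real^'n^'m \<Rightarrow> real"
  assumes N: "is_matrix_norm N"
  obtains c where "0 < c" "\<And>A. norm A \<le> c * N A"
proof -
  have nonneg: "\<And>A. 0 \<le> N A" and zero: "\<And>A. N A = 0 \<longleftrightarrow> A = 0"
    and scale: "\<And>c A. N (c *\<^sub>R A) = \<bar>c\<bar> * N A" and triangle: "\<And>A B. N (A + B) \<le> N A + N B"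
    using N by (auto simp: is_matrix_norm_def)
  have "convex_on UNIV N"
  proof (rule convex_onI)
    fix t :: real and A B
    assume "0 < t" "t < 1"
    then show "N ((1 - t) *\<^sub>R A + t *\<^sub>R B) \<le> (1 - t) * N A + t * N B"
      using triangle[of "(1 - t) *\<^sub>R A" "t *\<^sub>R B"] by (simp add: scale)
  qed simp
  then have "continuous_on UNIV N"
    by (intro convex_on_continuous) simp_all
  then have "continuous_on (sphere 0 1) N"
    by (rule continuous_on_subset) simp
  moreover have "sphere (0 :: real^'n^'m) 1 \<noteq> {}"
    by simp
  ultimately obtain B where B: "B \<in> sphere 0 1" "\<And>A. A \<in> sphere 0 1 \<Longrightarrow> N B \<le> N A"
    using continuous_attains_inf[OF compact_sphere] by metis
  have pos: "0 < N B"
    using B(1) nonneg[of B] zero[of B] by (auto simp: less_le)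
  have "norm A \<le> (1 / N B) * N A" for A
  proof (cases "A = 0")
    case False
    have "N B \<le> N ((1 / norm A) *\<^sub>R A)"
      using False by (intro B(2)) simp
    then show ?thesis
      using False pos by (simp add: scale field_simps)
  qed (simp add: nonneg pos)
  then show ?thesis
    using pos that[of "1 / N B"] by simp
qed

section \<open>Uniform control of the noise\<close>

text \<open>Convergence bounds \<open>E v\<close> by \<open>a v\<close> from some \<open>n0\<close>
  on, and monotonicity replaces \<open>a v\<close> by \<open>a n\<close>. The finitely many earlier
  terms have a fixed bound, which \<open>a n\<close> eventually exceeds.\<close>

lemma eventually_norm_le_of_scaled_tendsto_zero:
  fixes E :: "nat \<Rightarrow> 'a::real_normed_vector"
  assumes mono: "mono_on {1..} a" and top: "filterlim a at_top sequentially"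
    and lim: "(\<lambda>n. (1 / a n) *\<^sub>R E n) \<longlonglongrightarrow> 0"
  shows "\<forall>\<^sub>F n in sequentially. \<forall>v\<le>n. norm (E v) \<le> a n"
proof -
  have "\<forall>\<^sub>F n in sequentially. norm ((1 / a n) *\<^sub>R E n) < 1"
    using tendstoD[OF lim, of 1] by simp
  moreover have "\<forall>\<^sub>F n in sequentially. 0 < a n"
    using top by (simp add: filterlim_at_top_dense)
  \<comment> \<open>The conjunct \<open>1 \<le> n\<close> is carried along because \<open>a\<close>
    is monotone on \<open>{1..}\<close> only.\<close>
  ultimately have "\<forall>\<^sub>F n in sequentially. norm (E n) \<le> a n \<and> 1 \<le> n"
    using eventually_ge_at_top[of 1]
    by eventually_elim (simp add: field_simps)
  then obtain n0 where n0: "\<And>n. n0 \<le> n \<Longrightarrow> norm (E n) \<le> a n \<and> 1 \<le> n"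
    by (auto simp: eventually_at_top_linorder)
  define K where "K = (\<Sum>v<n0. norm (E v))"
  have "\<forall>\<^sub>F n in sequentially. K \<le> a n"
    using top by (simp add: filterlim_at_top)
  then show ?thesis
    using eventually_ge_at_top[of n0]
  proof eventually_elim
    case (elim n)
    show ?case
    proof (intro allI impI)
      fix v
      assume "v \<le> n"
      show "norm (E v) \<le> a n"
      proof (cases "v < n0")
        case True
        then have "norm (E v) \<le> K"
          unfolding K_def by (intro member_le_sum) auto
        with elim show ?thesis
          by simp
      next
        case False
        then have "norm (E v) \<le> a v" "1 \<le> v"
          using n0[of v] by auto
        moreover have "a v \<le> a n"
          using \<open>1 \<le> v\<close> \<open>v \<le> n\<close> by (intro mono_onD[OF mono]) auto
        ultimately show ?thesis
          by simp
      qed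
    qed
  qed
qed

section \<open>The CUSUM signal\<close>

text \<open>With \<open>m\<close> the last index before the change, this is the coefficient of
  \<Delta> in \<open>sqrt n\<close> times the noise-free \<open>cusum\<close>.\<close>

definition tent :: "nat \<Rightarrow> nat \<Rightarrow> nat \<Rightarrow> real" where
  "tent n m v = real (min v m) - real v * real m / real n"

text \<open>Used to drop the absolute value that homogeneity of \<open>pd_norm\<close> puts around
  the coefficient of \<Delta>.\<close>

lemma tent_nonneg:
  assumes "v \<le> n" "m \<le> n"
  shows "0 \<le> tent n m v"
proof (cases "n = 0")
  case False
  have "real v * real m \<le> real (min v m) * real n"
    using assms
    by (cases "v \<le> m") (auto simp: min_def mult.commute intro: mult_left_mono mult_right_mono)
  with False show ?thesis
    by (simp add: tent_def field_simps)
qed (simp add: tent_def)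

text \<open>The function is linear with slope \<open>1 - m / n\<close> up to \<open>m\<close> and
  slope \<open>- m / n\<close> after it, so the drop from the peak is exactly slope times distance,
  and \<open>c\<close> is below both slopes in absolute value.\<close>

lemma tent_drop:
  assumes "0 < n" "m \<le> n" "c \<le> real m / real n" "c \<le> 1 - real m / real n"
  shows "c * \<bar>real v - real m\<bar> \<le> tent n m m - tent n m v"
proof (cases "v \<le> m")
  case True
  then have "c * (real m - real v) \<le> (1 - real m / real n) * (real m - real v)"
    using assms by (intro mult_right_mono) auto
  also have "\<dots> = tent n m m - tent n m v"
    using True assms(1) by (simp add: tent_def field_simps)
  finally show ?thesis
    using True by simp
next
  case False
  then have "c * (real v - real m) \<le> (real m / real n) * (real v - real m)"
    using assms by (intro mult_right_mono) auto
  also have "\<dots> = tent n m m - tent n m v"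
    using False assms(1) by (simp add: tent_def field_simps)
  finally show ?thesis
    using False by simp
qed

text \<open>Each \<open>Y j\<close> is \<open>e j + (\<mu> - \<Delta>)\<close>, plus \<Delta> if
  \<open>j \<le> m\<close>. The constant part has partial sums linear in the index, which the
  centring cancels; the extra \<Delta> is counted \<open>min v m\<close> times.\<close>

lemma cusum_change_point:
  fixes e :: "nat \<Rightarrow> 'a::real_vector"
  assumes Y: "\<And>j. 1 \<le> j \<Longrightarrow> j \<le> n \<Longrightarrow> Y j = (if j \<le> m then e j + \<mu> else e j + \<mu> - \<Delta>)"
    and "0 < n" "v \<le> n" "m \<le> n"
  shows "cusum n Y v = (1 / sqrt (real n)) *\<^sub>R
    (tent n m v *\<^sub>R \<Delta> + ((\<Sum>j=1..v. e j) - (real v / real n) *\<^sub>R (\<Sum>j=1..n. e j)))"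
proof -
  have sum_Y: "(\<Sum>j=1..w. Y j) = (\<Sum>j=1..w. e j) + real w *\<^sub>R (\<mu> - \<Delta>) + real (min w m) *\<^sub>R \<Delta>"
    if "w \<le> n" for w
    using that
  proof (induction w)
    case (Suc w)
    show ?case
    proof (cases "Suc w \<le> m")
      case True
      then have "min (Suc w) m = Suc w" "min w m = w"
        by simp_all
      with True Suc show ?thesis
        by (simp add: Y algebra_simps)
    next
      case False
      then have "min (Suc w) m = m" "min w m = m"
        by simp_all
      with False Suc show ?thesis
        by (simp add: Y algebra_simps)
    qed
  qed simp
  have "real v / real n * real n = real v" "min n m = m"
    using assms by simp_all
  then show ?thesis
    unfolding cusum_def sum_Y[OF \<open>v \<le> n\<close>] sum_Y[OF order_refl] tent_def
    by (simp add: algebra_simps)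
qed

section \<open>Deterministic bound for the maximiser\<close>

text \<open>Comparing the objective at \<open>v\<close> and \<open>m\<close> costs two noise terms,
  each at most \<open>2 * K * s\<close> in units of \<open>pd_norm A \<Delta>\<close>. As
  \<open>K\<close> is relative to that length, the length cancels and the bound does not depend on
  the scale of \<open>A\<close>.\<close>

lemma change_point_distance:
  fixes A :: "real^'l^'l" and e :: "nat \<Rightarrow> real^'l"
  assumes Y: "\<And>j. 1 \<le> j \<Longrightarrow> j \<le> n \<Longrightarrow> Y j = (if j \<le> m then e j + \<mu> else e j + \<mu> - \<Delta>)"
    and A: "positive_definite A" and \<Delta>: "\<Delta> \<noteq> 0"
    and m: "1 \<le> m" "m \<le> n" and c: "c \<le> real m / real n" "c \<le> 1 - real m / real n"
    and K: "0 \<le> K" "\<And>x. pd_norm A x \<le> K * pd_norm A \<Delta> * norm x"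
    and noise: "\<And>w. w \<le> n \<Longrightarrow> norm (\<Sum>j=1..w. e j) \<le> s"
    and v: "is_arg_max (\<lambda>v. cusum n Y v \<bullet> (A *v cusum n Y v)) (\<lambda>v. v \<in> {1..n}) v"
  shows "c * \<bar>real v - real m\<bar> \<le> 4 * K * s"
proof -
  define R where "R w = (\<Sum>j=1..w. e j) - (real w / real n) *\<^sub>R (\<Sum>j=1..n. e j)" for w
  define T where "T w = tent n m w *\<^sub>R \<Delta> + R w" for w
  have n: "0 < n"
    using m by simp
  have vn: "v \<le> n" and max: "\<And>w. w \<in> {1..n} \<Longrightarrow>
      cusum n Y w \<bullet> (A *v cusum n Y w) \<le> cusum n Y v \<bullet> (A *v cusum n Y v)"
    using v by (auto simp: is_arg_max_def not_less)
  have cusum: "cusum n Y w = (1 / sqrt (real n)) *\<^sub>R T w" if "w \<le> n" for w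
    unfolding T_def R_def by (rule cusum_change_point) (use Y n m that in auto)
  have "pd_norm A (cusum n Y m) \<le> pd_norm A (cusum n Y v)"
    unfolding pd_norm_def using m by (intro real_sqrt_le_mono max) simp
  \<comment> \<open>The factor \<open>1 / sqrt n\<close> is common to both sides and
    cancels.\<close>
  then have le: "pd_norm A (T m) \<le> pd_norm A (T v)"
    using n by (simp add: cusum vn m pd_norm_scaleR divide_le_cancel)
  have R: "pd_norm A (R w) \<le> K * pd_norm A \<Delta> * (2 * s)" if "w \<le> n" for w
  proof -
    have "norm (R w) \<le> norm (\<Sum>j=1..w. e j) + real w / real n * norm (\<Sum>j=1..n. e j)"
      unfolding R_def by (rule order_trans[OF norm_triangle_ineq4]) simp
    \<comment> \<open>The total sum enters with weight \<open>w / n \<le> 1\<close>, so both sums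
      together contribute at most \<open>2 * s\<close>.\<close>
    also have "\<dots> \<le> s + 1 * s"
      using that n by (intro add_mono mult_mono noise) auto
    finally have "norm (R w) \<le> 2 * s"
      by simp
    then have "K * pd_norm A \<Delta> * norm (R w) \<le> K * pd_norm A \<Delta> * (2 * s)"
      using K(1) pd_norm_nonneg[OF A] by (intro mult_left_mono) auto
    with K(2)[of "R w"] show ?thesis
      by simp
  qed
  have "tent n m m * pd_norm A \<Delta> = pd_norm A (T m + (-1) *\<^sub>R R m)"
    using tent_nonneg[OF m(2) m(2)] by (simp add: T_def pd_norm_scaleR)
  also have "\<dots> \<le> pd_norm A (T m) + pd_norm A (R m)"
    using pd_norm_triangle[OF A, of "T m" "(-1) *\<^sub>R R m"] pd_norm_scaleR[of A "-1" "R m"] by simp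
  also have "\<dots> \<le> pd_norm A (T v) + pd_norm A (R m)"
    using le by simp
  also have "pd_norm A (T v) \<le> tent n m v * pd_norm A \<Delta> + pd_norm A (R v)"
    unfolding T_def using tent_nonneg[OF vn m(2)]
    by (intro order_trans[OF pd_norm_triangle[OF A]]) (simp add: pd_norm_scaleR)
  finally have "tent n m m * pd_norm A \<Delta> \<le> tent n m v * pd_norm A \<Delta> + 4 * K * s * pd_norm A \<Delta>"
    using R[OF vn] R[OF m(2)] by (simp add: algebra_simps)
  then have "(tent n m m - tent n m v) * pd_norm A \<Delta> \<le> (4 * K * s) * pd_norm A \<Delta>"
    by (simp add: algebra_simps)
  then have "tent n m m - tent n m v \<le> 4 * K * s"
    using pd_norm_pos[OF A \<Delta>] by simp
  with tent_drop[OF n m(2) c, of v] show ?thesis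
    by simp
qed

section \<open>Almost sure rate of the estimator\<close>

theorem theorem4p3:
  fixes M :: "'a measure"
    and X :: "nat \<Rightarrow> nat \<Rightarrow> 'a \<Rightarrow> nat \<Rightarrow> 'p::metric_space"
    and \<kappa> :: "(nat \<Rightarrow> 'p) \<Rightarrow> nat set \<Rightarrow> real"
    and r k :: nat
    and Z :: "nat \<Rightarrow> nat \<Rightarrow> 'a \<Rightarrow> real^('N::finite \<times> 2)"
    and f :: "real^('N \<times> 2) \<Rightarrow> real^'l"
    and L \<theta> :: real
    and \<mu> \<Delta> :: "real^'l"
    and e :: "nat \<Rightarrow> 'a \<Rightarrow> real^'l"
    and a :: "nat \<Rightarrow> real"
    and Y :: "nat \<Rightarrow> nat \<Rightarrow> 'a \<Rightarrow> real^'l"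
    and \<Sigma> :: "nat \<Rightarrow> 'a \<Rightarrow> real^'l^'l"
    and matnorm :: "real^'l^'l \<Rightarrow> real"
    and \<Omega>0 :: "'a set"
    and \<theta>hat :: "nat \<Rightarrow> 'a \<Rightarrow> real"
  assumes "prob_space M"
    and "CARD('N) = r choose (k + 1)"
    and "\<And>n j i. 1 \<le> j \<Longrightarrow> j \<le> n \<Longrightarrow> i < r \<Longrightarrow> (\<lambda>\<omega>. X n j \<omega> i) \<in> borel_measurable M"
    and "\<And>x. is_filtration r (\<kappa> x)"
    and "\<And>n j. 1 \<le> j \<Longrightarrow> j \<le> n \<Longrightarrow> Z n j \<in> borel_measurable M"
    and "\<And>n j \<omega>. 1 \<le> j \<Longrightarrow> j \<le> n \<Longrightarrow> \<omega> \<in> space M \<Longrightarrow>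
           is_feature_vector TYPE('k::field) r (\<kappa> (X n j \<omega>)) k (Z n j \<omega>)"
    and "L-lipschitz_on UNIV f"
    and "0 < \<theta>" and "\<theta> < 1"
    and "\<Delta> \<noteq> 0"
    and "\<And>j. 1 \<le> j \<Longrightarrow> integrable M (e j)"
    and "\<And>j. 1 \<le> j \<Longrightarrow> (\<integral>\<omega>. e j \<omega> \<partial>M) = 0"
    and "mono_on {1..} a"
    and "filterlim a at_top sequentially"
    and "AE \<omega> in M. (\<lambda>n. (1 / a n) *\<^sub>R (\<Sum>j=1..n. e j \<omega>)) \<longlonglongrightarrow> 0"
    and "a \<in> o(\<lambda>n. real n)"
    and "\<And>n j \<omega>. 1 \<le> j \<Longrightarrow> j \<le> n \<Longrightarrow> \<omega> \<in> space M \<Longrightarrow> Y n j \<omega> = f (Z n j \<omega>)"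
    and "\<And>n j \<omega>. 1 \<le> j \<Longrightarrow> j \<le> n \<Longrightarrow> \<omega> \<in> space M \<Longrightarrow>
           Y n j \<omega> = (if j \<le> nat \<lfloor>real n * \<theta>\<rfloor> then e j \<omega> + \<mu> else e j \<omega> + \<mu> - \<Delta>)"
    and "\<And>n. 1 \<le> n \<Longrightarrow> \<Sigma> n \<in> borel_measurable M"
    and "\<And>n \<omega>. 1 \<le> n \<Longrightarrow> \<omega> \<in> space M \<Longrightarrow> positive_definite (\<Sigma> n \<omega>)"
    and "\<And>n \<omega>. 1 \<le> n \<Longrightarrow> \<omega> \<in> space M \<Longrightarrow>
           \<exists>v. is_arg_max (\<lambda>v. cusum n (\<lambda>j. Y n j \<omega>) v \<bullet> (\<Sigma> n \<omega> *v cusum n (\<lambda>j. Y n j \<omega>) v))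
                 (\<lambda>v. v \<in> {1..n}) v
               \<and> \<theta>hat n \<omega> = real v / real n"
    and "is_matrix_norm matnorm"
    and "\<Omega>0 \<in> sets M" and "measure M \<Omega>0 = 1"
    and "\<And>\<omega>. \<omega> \<in> \<Omega>0 \<Longrightarrow>
           bdd_above ((\<lambda>n. matnorm (\<Sigma> n \<omega>) / (\<Delta> \<bullet> (\<Sigma> n \<omega> *v \<Delta>))) ` {1..})"
  shows "as_bigo M (\<lambda>n \<omega>. \<theta>hat n \<omega> - \<theta>) (\<lambda>n. a n / real n)"
proof -
  interpret prob_space M
    by fact
  note e_lim = assms(15) and Y = assms(18) and pd = assms(20) and arg_max = assms(21)
    and bdd = assms(25)
  obtain c0 where c0: "0 < c0" "\<And>A. norm A \<le> c0 * matnorm A"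
    using matrix_norm_dominates[OF assms(22)] by blast
  define m where "m n = nat \<lfloor>real n * \<theta>\<rfloor>" for n
  \<comment> \<open>A lower bound for both tent slopes at large \<open>n\<close>:
    \<open>m n \<le> n * \<theta>\<close> gives \<open>1 - \<theta>\<close>, while rounding down may
    cost part of \<theta>, of which half is kept.\<close>
  define c where "c = min (\<theta> / 2) (1 - \<theta>)"
  have c: "0 < c"
    using assms(8,9) by (simp add: c_def)
  have m: "real (m n) \<le> real n * \<theta>" "real n * \<theta> < real (m n) + 1" for n
    using assms(8) by (simp_all add: m_def)
  have m_le: "m n \<le> n" for n
    using m(1)[of n] assms(8,9) mult_left_le[of \<theta> "real n"] by linarith
  have "AE \<omega> in M. \<omega> \<in> \<Omega>0"
    using assms(23,24) by (simp add: AE_in_set_eq_1)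
  then show ?thesis
    unfolding as_bigo_def using e_lim AE_space
  proof eventually_elim
    case (elim \<omega>)
    obtain B where B: "\<And>n. 1 \<le> n \<Longrightarrow> matnorm (\<Sigma> n \<omega>) / (\<Delta> \<bullet> (\<Sigma> n \<omega> *v \<Delta>)) \<le> B"
      using bdd[OF elim(1)] by (auto simp: bdd_above_def)
    \<comment> \<open>\<open>c0\<close> passes from \<open>matnorm\<close> to \<open>norm\<close>,
      \<open>B\<close> bounds the assumed quotient, and the root appears because both bounds concern
      quadratic forms. The absolute value makes \<open>K\<close> visibly nonnegative.\<close>
    define K where "K = sqrt (c0 * \<bar>B\<bar>)"
    have K: "pd_norm (\<Sigma> n \<omega>) x \<le> K * pd_norm (\<Sigma> n \<omega>) \<Delta> * norm x" if "1 \<le> n" for n x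
    proof -
      note A = pd[OF that elim(3)]
      have pos: "0 < \<Delta> \<bullet> (\<Sigma> n \<omega> *v \<Delta>)"
        using A assms(10) by (simp add: positive_definite_def)
      have "matnorm (\<Sigma> n \<omega>) \<le> B * (\<Delta> \<bullet> (\<Sigma> n \<omega> *v \<Delta>))"
        using B[OF that] pos by (simp add: field_simps)
      also have "\<dots> \<le> \<bar>B\<bar> * (\<Delta> \<bullet> (\<Sigma> n \<omega> *v \<Delta>))"
        using pos by (intro mult_right_mono) auto
      finally have "c0 * matnorm (\<Sigma> n \<omega>) \<le> c0 * (\<bar>B\<bar> * (\<Delta> \<bullet> (\<Sigma> n \<omega> *v \<Delta>)))"
        using c0(1) by (intro mult_left_mono) auto
      then have "norm (\<Sigma> n \<omega>) \<le> c0 * \<bar>B\<bar> * (\<Delta> \<bullet> (\<Sigma> n \<omega> *v \<Delta>))"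
        using c0(2)[of "\<Sigma> n \<omega>"] by (simp add: mult.assoc)
      then have "sqrt (norm (\<Sigma> n \<omega>)) \<le> K * pd_norm (\<Sigma> n \<omega>) \<Delta>"
        unfolding K_def pd_norm_def real_sqrt_mult[symmetric] by simp
      then have "sqrt (norm (\<Sigma> n \<omega>)) * norm x \<le> K * pd_norm (\<Sigma> n \<omega>) \<Delta> * norm x"
        by (intro mult_right_mono) auto
      with pd_norm_le[OF A, of x] show ?thesis
        by simp
    qed
    have "\<forall>\<^sub>F n in sequentially. \<forall>v\<le>n. norm (\<Sum>j=1..v. e j \<omega>) \<le> a n"
      by (rule eventually_norm_le_of_scaled_tendsto_zero[OF assms(13,14) elim(2)])
    \<comment> \<open>Needed to absorb into \<open>a n\<close> the rounding error, less than 1,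
      between \<open>m n\<close> and \<open>n * \<theta>\<close>.\<close>
    moreover have "\<forall>\<^sub>F n in sequentially. 1 \<le> a n"
      using assms(14) by (simp add: filterlim_at_top)
    ultimately have "\<forall>\<^sub>F n in sequentially.
        norm (\<theta>hat n \<omega> - \<theta>) \<le> (4 * K / c + 1) * norm (a n / real n)"
      \<comment> \<open>From \<open>2 / \<theta>\<close> on, \<open>n * \<theta> \<ge> 2\<close>, so
        \<open>m n > n * \<theta> - 1\<close> yields both \<open>m n \<ge> 1\<close> and
        \<open>m n / n \<ge> \<theta> / 2\<close>.\<close>
      using eventually_ge_at_top[of "nat \<lceil>2 / \<theta>\<rceil>"] eventually_ge_at_top[of 1]
    proof eventually_elim
      case n: (elim n)
      have "2 / \<theta> \<le> real n"
        using n(3) by linarith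
      then have n\<theta>: "2 \<le> real n * \<theta>"
        using assms(8) by (simp add: field_simps)
      have "\<theta> / 2 \<le> real (m n) / real n" "1 - \<theta> \<le> 1 - real (m n) / real n"
        using m[of n] n\<theta> n(4) by (simp_all add: field_simps)
      then have c_le: "c \<le> real (m n) / real n" "c \<le> 1 - real (m n) / real n"
        by (auto simp: c_def intro: min.coboundedI1 min.coboundedI2)
      have m1: "1 \<le> m n"
        using m(2)[of n] n\<theta> by linarith
      obtain v where v: "is_arg_max (\<lambda>v. cusum n (\<lambda>j. Y n j \<omega>) v \<bullet>
            (\<Sigma> n \<omega> *v cusum n (\<lambda>j. Y n j \<omega>) v)) (\<lambda>v. v \<in> {1..n}) v"
        and \<theta>hat: "\<theta>hat n \<omega> = real v / real n"
        using arg_max[OF n(4) elim(3)] by blast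
      \<comment> \<open>The deterministic bound is applied with \<open>s = a n\<close>, valid for
        all partial sums up to \<open>n\<close> at once.\<close>
      have "c * \<bar>real v - real (m n)\<bar> \<le> 4 * K * a n"
      proof (rule change_point_distance[OF _ pd[OF n(4) elim(3)] assms(10) m1 m_le c_le _ K[OF n(4)] _ v])
        show "Y n j \<omega> = (if j \<le> m n then e j \<omega> + \<mu> else e j \<omega> + \<mu> - \<Delta>)"
          if "1 \<le> j" "j \<le> n" for j
          unfolding m_def by (rule Y[OF that elim(3)])
      qed (use n(1) c0(1) in \<open>auto simp: K_def\<close>)
      then have "\<bar>real v - real (m n)\<bar> \<le> 4 * K / c * a n"
        using c by (simp add: field_simps)
      then have "\<bar>real v - real n * \<theta>\<bar> \<le> 4 * K / c * a n + a n"
        using m[of n] n(2) by linarith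
      then have "\<bar>real v - real n * \<theta>\<bar> / real n \<le> (4 * K / c * a n + a n) / real n"
        by (intro divide_right_mono) auto
      moreover have "\<theta>hat n \<omega> - \<theta> = (real v - real n * \<theta>) / real n"
        using n(4) by (simp add: \<theta>hat field_simps)
      ultimately show ?case
        using n(2) by (simp add: algebra_simps add_divide_distrib)
    qed
    then show ?case
      by (rule bigoI)
  qed
qed

end
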